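(* Let $(X_1, X_2)$ and $(X_1^{\star}, X_2^{\star})$ be two random pairs with nonnegative entries and identical margins (i.e., $X_i$ and $X_i^\star$ have the same distribution for $i = 1, 2$). Suppose that the random variables $X_1^{\star}$ and $X_2^{\star}$ are independent, and that $(X_1, X_2) \preceq_{\mathrm{Lt}} (X_1^{\star}, X_2^{\star})$ in the multivariate Laplace transform order. If $f$ and $g$ are Bernstein functions with triplets $(a_1, 0, \mu_1)$ and $(a_2, 0, \mu_2)$, respectively, then \[ \mathbb{E}\{ f(X_1) g(X_2) \} \geq \mathbb{E}\{ f(X_1^{\star}) \} \, \mathbb{E}\{ g(X_2^{\star}) \}. \]
   Context: Multivariate Laplace transform order: for two $d$-variate random vectors $\boldsymbol{X}$ and $\boldsymbol{Y}$ with nonnegative entries, $\boldsymbol{X} \preceq_{\mathrm{Lt}} \boldsymbol{Y}$ if and only if $\mathbb{E}\big(e^{-\boldsymbol{t}^\top \boldsymbol{X}}\big) \ge \mathbb{E}\big(e^{-\boldsymbol{t}^\top \boldsymbol{Y}}\big)$ for all $\boldsymbol{t} \in (0,\infty)^d$. Bernstein function: a map $f : [0,\infty) \to \mathbb{R}$ is a Bernstein function with triplet $(a, b, \mu)$ if $a, b \in [0,\infty)$, $\mu$ is a (nonnegative) measure on $(0,\infty)$ with $\int_{(0,\infty)} \min(1,t)\, \mu(\mathrm{d}t) < \infty$, and for every real $\lambda \in [0,\infty)$, \[ f(\lambda) = a + b\lambda + \int_{(0,\infty)} (1 - e^{-\lambda t})\, \mu(\mathrm{d}t). \] Expectations of nonnegative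 random variables are taken in $[0,\infty]$, with the convention $0 \cdot \infty = 0$. *)

theory Defs
  imports "HOL-Probability.Probability"
begin

text \<open>
  The multivariate Laplace transform order, for random vectors that may live on different
  probability spaces \<open>M\<close> and \<open>N\<close>. Positivity of the entries of \<open>t\<close> refers to the standard basis,
  so for the type \<open>real \<times> real\<close> the condition reads \<open>t = (t1, t2)\<close> with \<open>0 < t1\<close> and \<open>0 < t2\<close>,
  and \<open>t \<bullet> X \<omega>\<close> is \<open>t1 * X1 \<omega> + t2 * X2 \<omega>\<close>. Measurability and nonnegativity of the entries
  of \<open>X\<close> and \<open>Y\<close> are not part of the definition.
\<close>
definition laplace_order ::
  "'m measure \<Rightarrow> ('m \<Rightarrow> 'a::euclidean_space) \<Rightarrow> 'n measure \<Rightarrow> ('n \<Rightarrow> 'a) \<Rightarrow> bool" where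
  "laplace_order M X N Y \<longleftrightarrow>
    (\<forall>t. (\<forall>i\<in>Basis. 0 < t \<bullet> i) \<longrightarrow>
      (\<integral>\<^sup>+\<omega>. ennreal (exp (- (t \<bullet> X \<omega>))) \<partial>M) \<ge> (\<integral>\<^sup>+\<omega>. ennreal (exp (- (t \<bullet> Y \<omega>))) \<partial>N))"

text \<open>
  Only the values of \<open>f\<close> on \<open>[0,\<infinity>)\<close> are constrained. The condition on \<open>sets \<mu>\<close> also gives
  \<open>space \<mu> = {0<..}\<close>. The Bochner integral below is never a junk value, since
  \<open>0 \<le> 1 - exp (- x * t) \<le> max 1 x * min 1 t\<close> for \<open>0 \<le> x\<close> and \<open>0 < t\<close>.
\<close>
definition bernstein_function ::
  "(real \<Rightarrow> real) \<Rightarrow> real \<Rightarrow> real \<Rightarrow> real measure \<Rightarrow> bool" where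
  "bernstein_function f a b \<mu> \<longleftrightarrow>
    0 \<le> a \<and> 0 \<le> b \<and>
    sets \<mu> = sets (restrict_space borel {0<..}) \<and>
    (\<integral>\<^sup>+t. ennreal (min 1 t) \<partial>\<mu>) < \<infinity> \<and>
    (\<forall>x\<ge>0. f x = a + b * x + (\<integral>t. (1 - exp (- x * t)) \<partial>\<mu>))"

end

theory Submission
  imports Defs
begin

text \<open>
  Writing the Bernstein functions as mixtures of \<open>1 - exp (- x * t)\<close> and using Tonelli's theorem,
  the claim reduces to the kernels: the margins agree, so the only term that differs between
  the two pairs in \<open>E ((1 - exp (- s * X1)) * (1 - exp (- t * X2)))\<close> is the joint Laplace transform,
  which is larger for \<open>(X1, X2)\<close> by assumption.
\<close>

section \<open>Bernstein triplets: measurability, sigma-finiteness and the nonnegative integral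
  form\<close>

lemma bernstein_measurable_ident:
  assumes "bernstein_function f a b \<mu>"
  shows "(\<lambda>t. t) \<in> borel_measurable \<mu>"
proof -
  have "sets \<mu> = sets (restrict_space borel {0<..})"
    using assms by (simp add: bernstein_function_def)
  then have "measurable \<mu> borel = measurable (restrict_space borel {0<..}) (borel :: real measure)"
    by (rule measurable_cong_sets) simp
  then show ?thesis
    by (simp add: measurable_restrict_space1)
qed

lemma bernstein_space:
  assumes "bernstein_function f a b \<mu>"
  shows "space \<mu> = {0<..}"
proof -
  have "sets \<mu> = sets (restrict_space borel {0<..})"
    using assms by (simp add: bernstein_function_def)
  then have "space \<mu> = space (restrict_space borel {0::real<..})"
    by (rule sets_eq_imp_space_eq)
  then show ?thesis by (simp add: space_restrict_space)
qed

text \<open>Tonelli's theorem is applied to \<mu> later, and \<mu> may have infinite mass near 0.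
  The function \<open>min 1 t\<close> is strictly positive with finite integral, so Markov's
  inequality bounds the mass of its superlevel sets, and these exhaust the space.\<close>

lemma bernstein_sigma_finite:
  assumes "bernstein_function f a b \<mu>"
  shows "sigma_finite_measure \<mu>"
proof -
  note [measurable] = bernstein_measurable_ident[OF assms]
  note sp = bernstein_space[OF assms]
  \<comment> \<open>This is the set where \<open>min 1 t\<close> is at least
    \<open>1 / Suc n\<close>, written as a product to fit Markov's inequality in
    \<open>ennreal\<close>.\<close>
  define A where "A n = {t \<in> space \<mu>. 1 \<le> ennreal (real (Suc n)) * ennreal (min 1 t)}" for n
  have [measurable]: "A n \<in> sets \<mu>" for n
    unfolding A_def by measurable
  have fin: "emeasure \<mu> (A n) \<noteq> \<infinity>" for n
  proof -
    have "emeasure \<mu> (A n) \<le> ennreal (real (Suc n)) * (\<integral>\<^sup>+t. ennreal (min 1 t) * indicator (space \<mu>) t \<partial>\<mu>)"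
      unfolding A_def by (intro nn_integral_Markov_inequality) auto
    also have "(\<integral>\<^sup>+t. ennreal (min 1 t) * indicator (space \<mu>) t \<partial>\<mu>) = (\<integral>\<^sup>+t. ennreal (min 1 t) \<partial>\<mu>)"
      by (intro nn_integral_cong) auto
    also have "ennreal (real (Suc n)) * \<dots> < \<infinity>"
      using assms by (simp add: bernstein_function_def ennreal_mult_less_top)
    finally show ?thesis by simp
  qed
  have "space \<mu> \<subseteq> (\<Union>n. A n)"
  proof
    fix t assume t: "t \<in> space \<mu>"
    then have "0 < min 1 t" by (simp add: sp)
    then obtain n where "inverse (real (Suc n)) < min 1 t"
      using reals_Archimedean by blast
    then have "inverse (real (Suc n)) * real (Suc n) \<le> min 1 t * real (Suc n)"
      by (intro mult_right_mono) simp_all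
    then have "1 \<le> real (Suc n) * min 1 t"
      by (simp add: mult.commute del: of_nat_Suc)
    then have "1 \<le> ennreal (real (Suc n) * min 1 t)"
      by (simp del: of_nat_Suc)
    also have "\<dots> = ennreal (real (Suc n)) * ennreal (min 1 t)"
      using \<open>0 < min 1 t\<close> by (intro ennreal_mult) auto
    finally show "t \<in> (\<Union>n. A n)" using t by (auto simp: A_def)
  qed
  moreover have "A n \<subseteq> space \<mu>" for n by (auto simp: A_def)
  ultimately have "(\<Union>n. A n) = space \<mu>" by blast
  then show ?thesis
    using fin by (intro sigma_finite_measure.intro exI[of _ "range A"]) auto
qed

text \<open>Dominates the kernel by a multiple of the function that a Bernstein measure integrates.
  For small \<open>t\<close> the bound comes from \<open>1 + y \<le> exp y\<close>, for large
  \<open>t\<close> from the trivial bound 1.\<close>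

lemma one_minus_exp_le:
  fixes x t :: real
  assumes "0 \<le> x" "0 < t"
  shows "1 - exp (- (x * t)) \<le> max 1 x * min 1 t"
proof (cases "t \<le> 1")
  case True
  have "1 - exp (- (x * t)) \<le> x * t"
    using exp_ge_add_one_self[of "- (x * t)"] by linarith
  also have "\<dots> \<le> max 1 x * min 1 t"
    using assms True by (intro mult_mono) auto
  finally show ?thesis .
next
  case False
  then have "min 1 t = 1" by simp
  moreover have "1 - exp (- (x * t)) \<le> 1" by simp
  ultimately show ?thesis by (simp add: le_max_iff_disj)
qed

text \<open>Passing to the nonnegative integral makes Tonelli's theorem available without
  integrability conditions on the expectations. The two integrals agree because the kernel is
  nonnegative and dominated by \<open>max 1 x * min 1 t\<close>.\<close>

lemma bernstein_nn_integral:
  assumes f: "bernstein_function f a 0 \<mu>" and x: "0 \<le> x"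
  shows "0 \<le> f x"
    and "ennreal (f x) = ennreal a + (\<integral>\<^sup>+t. ennreal (1 - exp (- (x * t))) \<partial>\<mu>)"
proof -
  note [measurable] = bernstein_measurable_ident[OF f]
  note sp = bernstein_space[OF f]
  have a: "0 \<le> a" using f by (simp add: bernstein_function_def)
  have nonneg: "0 \<le> 1 - exp (- (x * t))" if "t \<in> space \<mu>" for t
    using that x by (simp add: sp)
  have "(\<integral>\<^sup>+t. ennreal (1 - exp (- (x * t))) \<partial>\<mu>)
      \<le> (\<integral>\<^sup>+t. ennreal (max 1 x) * ennreal (min 1 t) \<partial>\<mu>)"
  proof (rule nn_integral_mono)
    fix t assume "t \<in> space \<mu>"
    then have t: "0 < t" by (simp add: sp)
    have "ennreal (1 - exp (- (x * t))) \<le> ennreal (max 1 x * min 1 t)"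
      by (intro ennreal_leI one_minus_exp_le x t)
    also have "\<dots> = ennreal (max 1 x) * ennreal (min 1 t)"
      using t by (intro ennreal_mult) auto
    finally show "ennreal (1 - exp (- (x * t))) \<le> ennreal (max 1 x) * ennreal (min 1 t)" .
  qed
  also have "\<dots> = ennreal (max 1 x) * (\<integral>\<^sup>+t. ennreal (min 1 t) \<partial>\<mu>)"
    by (rule nn_integral_cmult) measurable
  also have "\<dots> < \<infinity>"
    using f by (simp add: bernstein_function_def ennreal_mult_less_top)
  finally have "integrable \<mu> (\<lambda>t. 1 - exp (- (x * t)))"
    using nonneg by (intro integrableI_nonneg AE_I2) auto
  then have eq: "(\<integral>\<^sup>+t. ennreal (1 - exp (- (x * t))) \<partial>\<mu>) = ennreal (\<integral>t. (1 - exp (- (x * t))) \<partial>\<mu>)"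
    using nonneg by (intro nn_integral_eq_integral AE_I2) auto
  have int: "0 \<le> (\<integral>t. (1 - exp (- (x * t))) \<partial>\<mu>)"
    using nonneg by (intro integral_nonneg_AE AE_I2)
  have fx: "f x = a + (\<integral>t. (1 - exp (- (x * t))) \<partial>\<mu>)"
    using f x by (simp add: bernstein_function_def)
  show "0 \<le> f x"
    using a int fx by simp
  show "ennreal (f x) = ennreal a + (\<integral>\<^sup>+t. ennreal (1 - exp (- (x * t))) \<partial>\<mu>)"
    unfolding eq fx using a int by simp
qed

section \<open>Exponentials of nonnegative variables, and integrals that depend only on the
  distribution\<close>

lemma (in prob_space) integrable_exp_minus:
  fixes X :: "'a \<Rightarrow> real"
  assumes [measurable]: "X \<in> borel_measurable M" and "AE \<omega> in M. 0 \<le> X \<omega>"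
  shows "integrable M (\<lambda>\<omega>. exp (- X \<omega>))"
proof (rule integrable_const_bound[where B = 1])
  show "AE \<omega> in M. norm (exp (- X \<omega>)) \<le> 1"
    using assms(2) by eventually_elim simp
qed measurable

lemma integral_cong_distr:
  fixes h :: "real \<Rightarrow> real"
  assumes "X \<in> borel_measurable M" "Y \<in> borel_measurable N" "distr M borel X = distr N borel Y"
    and "h \<in> borel_measurable borel"
  shows "(\<integral>\<omega>. h (X \<omega>) \<partial>M) = (\<integral>\<omega>. h (Y \<omega>) \<partial>N)"
  using integral_distr[OF assms(1,4)] integral_distr[OF assms(2,4)] assms(3) by simp

lemma nn_integral_cong_distr:
  assumes "X \<in> borel_measurable M" "Y \<in> borel_measurable N" "distr M borel X = distr N borel Y"
    and "h \<in> borel_measurable borel"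
  shows "(\<integral>\<^sup>+\<omega>. h (X \<omega>) \<partial>M) = (\<integral>\<^sup>+\<omega>. h (Y \<omega>) \<partial>N)"
  using nn_integral_distr[OF assms(1), of h] nn_integral_distr[OF assms(2), of h] assms(3,4) by simp

section \<open>The inequality for a single pair of exponential kernels\<close>

text \<open>Expanding the products, the left side is \<open>1 - L1 - L2 + Ls\<close> and the right
  side is \<open>1 - L1 - L2 + L\<close>, where \<open>L1\<close>, \<open>L2\<close> are the common
  marginal Laplace transforms and \<open>Ls\<close>, \<open>L\<close> the joint ones. The order
  gives \<open>Ls \<le> L\<close>.\<close>

lemma laplace_kernel_ge:
  fixes M :: "'m measure" and N :: "'n measure"
    and X1 X2 :: "'m \<Rightarrow> real" and X1s X2s :: "'n \<Rightarrow> real" and s t :: real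
  assumes "prob_space M" and "prob_space N"
    and [measurable]: "X1 \<in> borel_measurable M" "X2 \<in> borel_measurable M"
      "X1s \<in> borel_measurable N" "X2s \<in> borel_measurable N"
    and pos: "AE \<omega> in M. 0 \<le> X1 \<omega>" "AE \<omega> in M. 0 \<le> X2 \<omega>"
      "AE \<omega> in N. 0 \<le> X1s \<omega>" "AE \<omega> in N. 0 \<le> X2s \<omega>"
    and d1: "distr M borel X1 = distr N borel X1s"
    and d2: "distr M borel X2 = distr N borel X2s"
    and ind: "prob_space.indep_var N borel X1s borel X2s"
    and lo: "laplace_order M (\<lambda>\<omega>. (X1 \<omega>, X2 \<omega>)) N (\<lambda>\<omega>. (X1s \<omega>, X2s \<omega>))"
    and st: "0 < s" "0 < t"
  shows "(\<integral>\<^sup>+\<omega>. ennreal (1 - exp (- (X1s \<omega> * s))) \<partial>N) * (\<integral>\<^sup>+\<omega>. ennreal (1 - exp (- (X2s \<omega> * t))) \<partial>N)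
    \<le> (\<integral>\<^sup>+\<omega>. ennreal (1 - exp (- (X1 \<omega> * s))) * ennreal (1 - exp (- (X2 \<omega> * t))) \<partial>M)"
proof -
  interpret M: prob_space M by fact
  interpret N: prob_space N by fact
  \<comment> \<open>Nonnegative exponents keep the exponentials at most 1, which gives both the
    integrability in \<open>i\<close> and the signs needed to exchange the two kinds of
    integral.\<close>
  have ae[simp]:
    "AE \<omega> in M. 0 \<le> X1 \<omega> * s" "AE \<omega> in M. 0 \<le> X2 \<omega> * t" "AE \<omega> in M. 0 \<le> X1 \<omega> * s + X2 \<omega> * t"
    "AE \<omega> in N. 0 \<le> X1s \<omega> * s" "AE \<omega> in N. 0 \<le> X2s \<omega> * t" "AE \<omega> in N. 0 \<le> X1s \<omega> * s + X2s \<omega> * t"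
    using pos st by auto
  have i[simp]:
    "integrable M (\<lambda>\<omega>. exp (- (X1 \<omega> * s)))" "integrable M (\<lambda>\<omega>. exp (- (X2 \<omega> * t)))"
    "integrable M (\<lambda>\<omega>. exp (- (X1 \<omega> * s + X2 \<omega> * t)))"
    "integrable N (\<lambda>\<omega>. exp (- (X1s \<omega> * s)))" "integrable N (\<lambda>\<omega>. exp (- (X2s \<omega> * t)))"
    "integrable N (\<lambda>\<omega>. exp (- (X1s \<omega> * s + X2s \<omega> * t)))"
    by (intro M.integrable_exp_minus N.integrable_exp_minus ae; measurable)+
  define L1 L2 L Ls where "L1 = (\<integral>\<omega>. exp (- (X1s \<omega> * s)) \<partial>N)" and "L2 = (\<integral>\<omega>. exp (- (X2s \<omega> * t)) \<partial>N)"
    and "L = (\<integral>\<omega>. exp (- (X1 \<omega> * s + X2 \<omega> * t)) \<partial>M)" and "Ls = (\<integral>\<omega>. exp (- (X1s \<omega> * s + X2s \<omega> * t)) \<partial>N)"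
  have L1': "(\<integral>\<omega>. exp (- (X1 \<omega> * s)) \<partial>M) = L1"
    unfolding L1_def by (rule integral_cong_distr[OF _ _ d1]) measurable
  have L2': "(\<integral>\<omega>. exp (- (X2 \<omega> * t)) \<partial>M) = L2"
    unfolding L2_def by (rule integral_cong_distr[OF _ _ d2]) measurable
  \<comment> \<open>Independence factorises the joint transform of the starred pair, giving
    \<open>Ls = L1 * L2\<close>.\<close>
  have "N.indep_var borel ((\<lambda>x. exp (- (x * s))) \<circ> X1s) borel ((\<lambda>x. exp (- (x * t))) \<circ> X2s)"
    by (rule N.indep_var_compose[OF ind]) measurable
  then have "(\<integral>\<omega>. exp (- (X1s \<omega> * s)) * exp (- (X2s \<omega> * t)) \<partial>N) = L1 * L2"
    unfolding L1_def L2_def by (intro N.indep_var_lebesgue_integral) (auto simp: comp_def)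
  then have Ls: "Ls = L1 * L2"
    unfolding Ls_def by (simp add: exp_add[symmetric] add.commute)
  have "(\<integral>\<^sup>+\<omega>. ennreal (exp (- (X1s \<omega> * s + X2s \<omega> * t))) \<partial>N)
      \<le> (\<integral>\<^sup>+\<omega>. ennreal (exp (- (X1 \<omega> * s + X2 \<omega> * t))) \<partial>M)"
  proof -
    \<comment> \<open>The order is used at the single point \<open>(s, t)\<close>, whose coordinates
      are positive.\<close>
    have "\<forall>i\<in>Basis. 0 < (s, t) \<bullet> i"
      using st by (auto simp: Basis_prod_def)
    then have "(\<integral>\<^sup>+\<omega>. ennreal (exp (- ((s, t) \<bullet> (X1s \<omega>, X2s \<omega>)))) \<partial>N)
        \<le> (\<integral>\<^sup>+\<omega>. ennreal (exp (- ((s, t) \<bullet> (X1 \<omega>, X2 \<omega>)))) \<partial>M)"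
      using lo by (simp only: laplace_order_def)
    then show ?thesis
      by (simp add: mult.commute)
  qed
  then have "ennreal Ls \<le> ennreal L"
    unfolding L_def Ls_def by (subst (asm) (1 2) nn_integral_eq_integral) (auto simp del: minus_add_distrib)
  then have "Ls \<le> L"
    by (subst (asm) ennreal_le_iff) (auto simp: L_def simp del: minus_add_distrib)
  have e1: "(\<integral>\<^sup>+\<omega>. ennreal (1 - exp (- (X1s \<omega> * s))) \<partial>N) = ennreal (1 - L1)"
    unfolding L1_def by (subst nn_integral_eq_integral) (auto simp: N.prob_space)
  have e2: "(\<integral>\<^sup>+\<omega>. ennreal (1 - exp (- (X2s \<omega> * t))) \<partial>N) = ennreal (1 - L2)"
    unfolding L2_def by (subst nn_integral_eq_integral) (auto simp: N.prob_space)
  \<comment> \<open>Provides the sign of \<open>1 - L1\<close>; one nonnegative factor suffices to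
    merge the two \<open>ennreal\<close> factors at the end.\<close>
  have "L1 \<le> 1"
    using ae(4) unfolding L1_def by (intro N.integral_le_const) auto
  have e3: "(\<integral>\<^sup>+\<omega>. ennreal (1 - exp (- (X1 \<omega> * s))) * ennreal (1 - exp (- (X2 \<omega> * t))) \<partial>M)
    = ennreal (1 - L1 - L2 + L)"
  proof -
    have "(\<integral>\<^sup>+\<omega>. ennreal (1 - exp (- (X1 \<omega> * s))) * ennreal (1 - exp (- (X2 \<omega> * t))) \<partial>M)
      = (\<integral>\<^sup>+\<omega>. ennreal (1 - exp (- (X1 \<omega> * s)) - exp (- (X2 \<omega> * t)) + exp (- (X1 \<omega> * s + X2 \<omega> * t))) \<partial>M)"
    proof (rule nn_integral_cong_AE)
      show "AE \<omega> in M. ennreal (1 - exp (- (X1 \<omega> * s))) * ennreal (1 - exp (- (X2 \<omega> * t)))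
        = ennreal (1 - exp (- (X1 \<omega> * s)) - exp (- (X2 \<omega> * t)) + exp (- (X1 \<omega> * s + X2 \<omega> * t)))"
        using ae(1,2)
        by eventually_elim
          (simp add: ennreal_mult[symmetric] algebra_simps exp_add[symmetric])
    qed
    also have "\<dots> = ennreal (\<integral>\<omega>. (1 - exp (- (X1 \<omega> * s)) - exp (- (X2 \<omega> * t)) + exp (- (X1 \<omega> * s + X2 \<omega> * t))) \<partial>M)"
    proof (rule nn_integral_eq_integral)
      \<comment> \<open>The sign is invisible in expanded form, so it is read off from the factored
        form.\<close>
      show "AE \<omega> in M. 0 \<le> 1 - exp (- (X1 \<omega> * s)) - exp (- (X2 \<omega> * t)) + exp (- (X1 \<omega> * s + X2 \<omega> * t))"
        using ae(1,2)
      proof eventually_elim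
        case (elim \<omega>)
        then have "0 \<le> (1 - exp (- (X1 \<omega> * s))) * (1 - exp (- (X2 \<omega> * t)))"
          by simp
        then show ?case
          by (simp add: algebra_simps exp_add[symmetric])
      qed
    qed (intro Bochner_Integration.integrable_add Bochner_Integration.integrable_diff i M.integrable_const)
    also have "(\<integral>\<omega>. (1 - exp (- (X1 \<omega> * s)) - exp (- (X2 \<omega> * t)) + exp (- (X1 \<omega> * s + X2 \<omega> * t))) \<partial>M)
      = 1 - L1 - L2 + L"
      using i by (simp add: L1' L2' L_def M.prob_space del: minus_add_distrib)
    finally show ?thesis .
  qed
  have "ennreal (1 - L1) * ennreal (1 - L2) = ennreal ((1 - L1) * (1 - L2))"
    using \<open>L1 \<le> 1\<close> by (simp add: ennreal_mult')
  also have "\<dots> \<le> ennreal (1 - L1 - L2 + L)"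
    using \<open>Ls \<le> L\<close> by (intro ennreal_leI) (simp add: Ls algebra_simps)
  finally show ?thesis
    unfolding e1 e2 e3 .
qed

section \<open>Integration of the kernel inequality over the two mixing measures\<close>

theorem theorem2:
  fixes M :: "'m measure" and N :: "'n measure"
    and X1 X2 :: "'m \<Rightarrow> real" and X1s X2s :: "'n \<Rightarrow> real"
    and f g :: "real \<Rightarrow> real" and a1 a2 :: real and \<mu>1 \<mu>2 :: "real measure"
  assumes "prob_space M" and "prob_space N"
    and "X1 \<in> borel_measurable M" and "X2 \<in> borel_measurable M"
    and "X1s \<in> borel_measurable N" and "X2s \<in> borel_measurable N"
    and "AE \<omega> in M. 0 \<le> X1 \<omega>" and "AE \<omega> in M. 0 \<le> X2 \<omega>"
    and "AE \<omega> in N. 0 \<le> X1s \<omega>" and "AE \<omega> in N. 0 \<le> X2s \<omega>"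
    and "distr M borel X1 = distr N borel X1s"
    and "distr M borel X2 = distr N borel X2s"
    and "prob_space.indep_var N borel X1s borel X2s"
    and "laplace_order M (\<lambda>\<omega>. (X1 \<omega>, X2 \<omega>)) N (\<lambda>\<omega>. (X1s \<omega>, X2s \<omega>))"
    and "bernstein_function f a1 0 \<mu>1" and "bernstein_function g a2 0 \<mu>2"
  shows "(\<integral>\<^sup>+\<omega>. ennreal (f (X1 \<omega>) * g (X2 \<omega>)) \<partial>M)
    \<ge> (\<integral>\<^sup>+\<omega>. ennreal (f (X1s \<omega>)) \<partial>N) * (\<integral>\<^sup>+\<omega>. ennreal (g (X2s \<omega>)) \<partial>N)"
proof -
  interpret M: prob_space M by fact
  interpret N: prob_space N by fact
  note [measurable] = assms(3-6)
  note bf = \<open>bernstein_function f a1 0 \<mu>1\<close> and bg = \<open>bernstein_function g a2 0 \<mu>2\<close>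
  note [measurable] = bernstein_measurable_ident[OF bf] bernstein_measurable_ident[OF bg]
  interpret \<mu>1: sigma_finite_measure \<mu>1 by (rule bernstein_sigma_finite[OF bf])
  interpret \<mu>2: sigma_finite_measure \<mu>2 by (rule bernstein_sigma_finite[OF bg])
  interpret M1: pair_sigma_finite M \<mu>1 ..
  interpret M2: pair_sigma_finite M \<mu>2 ..
  interpret N1: pair_sigma_finite N \<mu>1 ..
  interpret N2: pair_sigma_finite N \<mu>2 ..
  \<comment> \<open>Nothing is known about \<open>f\<close> and \<open>g\<close> at negative
    arguments, not even measurability. \<open>A\<close> and \<open>B\<close> are Borel on the whole
    line (and 0 at negative arguments, since \<open>ennreal\<close> truncates there), so
    expectations are rewritten almost everywhere in terms of them.\<close>
  define A where "A x = (\<integral>\<^sup>+s. ennreal (1 - exp (- (x * s))) \<partial>\<mu>1)" for x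
  define B where "B x = (\<integral>\<^sup>+t. ennreal (1 - exp (- (x * t))) \<partial>\<mu>2)" for x
  have [measurable]: "A \<in> borel_measurable borel" "B \<in> borel_measurable borel"
    unfolding A_def B_def by measurable
  define a b where "a = ennreal a1" and "b = ennreal a2"
  have f: "0 \<le> f x" "ennreal (f x) = a + A x" and g: "0 \<le> g x" "ennreal (g x) = b + B x" if "0 \<le> x" for x
    unfolding a_def b_def A_def B_def
    using bernstein_nn_integral[OF bf that] bernstein_nn_integral[OF bg that] by auto
  have fgs: "(\<integral>\<^sup>+\<omega>. ennreal (f (X1s \<omega>)) \<partial>N) = a + (\<integral>\<^sup>+\<omega>. A (X1s \<omega>) \<partial>N)"
      "(\<integral>\<^sup>+\<omega>. ennreal (g (X2s \<omega>)) \<partial>N) = b + (\<integral>\<^sup>+\<omega>. B (X2s \<omega>) \<partial>N)"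
  proof -
    have "(\<integral>\<^sup>+\<omega>. ennreal (f (X1s \<omega>)) \<partial>N) = (\<integral>\<^sup>+\<omega>. a + A (X1s \<omega>) \<partial>N)"
      using assms(9) by (intro nn_integral_cong_AE) (auto simp: f)
    then show "(\<integral>\<^sup>+\<omega>. ennreal (f (X1s \<omega>)) \<partial>N) = a + (\<integral>\<^sup>+\<omega>. A (X1s \<omega>) \<partial>N)"
      by (simp add: nn_integral_add N.emeasure_space_1)
    have "(\<integral>\<^sup>+\<omega>. ennreal (g (X2s \<omega>)) \<partial>N) = (\<integral>\<^sup>+\<omega>. b + B (X2s \<omega>) \<partial>N)"
      using assms(10) by (intro nn_integral_cong_AE) (auto simp: g)
    then show "(\<integral>\<^sup>+\<omega>. ennreal (g (X2s \<omega>)) \<partial>N) = b + (\<integral>\<^sup>+\<omega>. B (X2s \<omega>) \<partial>N)"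
      by (simp add: nn_integral_add N.emeasure_space_1)
  qed
  have mA: "(\<integral>\<^sup>+\<omega>. A (X1 \<omega>) \<partial>M) = (\<integral>\<^sup>+\<omega>. A (X1s \<omega>) \<partial>N)"
    by (rule nn_integral_cong_distr[OF _ _ assms(11)]) measurable
  have mB: "(\<integral>\<^sup>+\<omega>. B (X2 \<omega>) \<partial>M) = (\<integral>\<^sup>+\<omega>. B (X2s \<omega>) \<partial>N)"
    by (rule nn_integral_cong_distr[OF _ _ assms(12)]) measurable
  \<comment> \<open>Tonelli's theorem moves the expectations inside the mixing integrals, so that
    the kernel inequality can be applied for each \<open>s\<close> and \<open>t\<close>.\<close>
  have "(\<integral>\<^sup>+\<omega>. A (X1s \<omega>) \<partial>N) * (\<integral>\<^sup>+\<omega>. B (X2s \<omega>) \<partial>N)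
    = (\<integral>\<^sup>+s. (\<integral>\<^sup>+\<omega>. ennreal (1 - exp (- (X1s \<omega> * s))) \<partial>N) \<partial>\<mu>1) *
      (\<integral>\<^sup>+t. (\<integral>\<^sup>+\<omega>. ennreal (1 - exp (- (X2s \<omega> * t))) \<partial>N) \<partial>\<mu>2)"
    unfolding A_def B_def by (subst N1.Fubini', measurable, subst N2.Fubini', measurable)
  also have "\<dots> = (\<integral>\<^sup>+s. \<integral>\<^sup>+t. (\<integral>\<^sup>+\<omega>. ennreal (1 - exp (- (X1s \<omega> * s))) \<partial>N) *
      (\<integral>\<^sup>+\<omega>. ennreal (1 - exp (- (X2s \<omega> * t))) \<partial>N) \<partial>\<mu>2 \<partial>\<mu>1)"
    by (simp add: nn_integral_cmult nn_integral_multc)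
  \<comment> \<open>The kernel inequality applies pointwise because both mixing measures live on
    \<open>{0<..}\<close>.\<close>
  also have "\<dots> \<le> (\<integral>\<^sup>+s. \<integral>\<^sup>+t. (\<integral>\<^sup>+\<omega>. ennreal (1 - exp (- (X1 \<omega> * s))) *
      ennreal (1 - exp (- (X2 \<omega> * t))) \<partial>M) \<partial>\<mu>2 \<partial>\<mu>1)"
    by (intro nn_integral_mono laplace_kernel_ge[OF assms(1-14)])
      (simp_all add: bernstein_space[OF bf] bernstein_space[OF bg])
  \<comment> \<open>Two exchanges with \<open>M\<close>, first for \<open>\<mu>2\<close> and then
    for \<open>\<mu>1\<close>, collect the kernels back into \<open>B\<close> and
    \<open>A\<close>.\<close>
  also have "\<dots> = (\<integral>\<^sup>+s. \<integral>\<^sup>+\<omega>. ennreal (1 - exp (- (X1 \<omega> * s))) * B (X2 \<omega>) \<partial>M \<partial>\<mu>1)"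
    unfolding B_def by (subst M2.Fubini') (simp_all add: nn_integral_cmult)
  also have "\<dots> = (\<integral>\<^sup>+\<omega>. A (X1 \<omega>) * B (X2 \<omega>) \<partial>M)"
    unfolding A_def by (subst M1.Fubini') (simp_all add: nn_integral_multc)
  finally have AB: "(\<integral>\<^sup>+\<omega>. A (X1s \<omega>) \<partial>N) * (\<integral>\<^sup>+\<omega>. B (X2s \<omega>) \<partial>N) \<le> (\<integral>\<^sup>+\<omega>. A (X1 \<omega>) * B (X2 \<omega>) \<partial>M)" .
  \<comment> \<open>The constant and the two mixed terms agree for both pairs by equality of
    margins, so only the last product needs \<open>AB\<close>. No subtraction occurs, so infinite
    expectations are covered, with \<open>0 * \<infinity> = 0\<close> in
    \<open>ennreal\<close>.\<close>
  have "(a + (\<integral>\<^sup>+\<omega>. A (X1s \<omega>) \<partial>N)) * (b + (\<integral>\<^sup>+\<omega>. B (X2s \<omega>) \<partial>N))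
    = a * b + a * (\<integral>\<^sup>+\<omega>. B (X2 \<omega>) \<partial>M) + (\<integral>\<^sup>+\<omega>. A (X1 \<omega>) \<partial>M) * b
      + (\<integral>\<^sup>+\<omega>. A (X1s \<omega>) \<partial>N) * (\<integral>\<^sup>+\<omega>. B (X2s \<omega>) \<partial>N)"
    by (simp add: mA mB algebra_simps)
  also have "\<dots> \<le> a * b + a * (\<integral>\<^sup>+\<omega>. B (X2 \<omega>) \<partial>M) + (\<integral>\<^sup>+\<omega>. A (X1 \<omega>) \<partial>M) * b
      + (\<integral>\<^sup>+\<omega>. A (X1 \<omega>) * B (X2 \<omega>) \<partial>M)"
    using AB by (rule add_left_mono)
  also have "\<dots> = (\<integral>\<^sup>+\<omega>. a * b + a * B (X2 \<omega>) + A (X1 \<omega>) * b + A (X1 \<omega>) * B (X2 \<omega>) \<partial>M)"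
    by (simp add: nn_integral_add nn_integral_cmult nn_integral_multc M.emeasure_space_1)
  also have "\<dots> = (\<integral>\<^sup>+\<omega>. ennreal (f (X1 \<omega>) * g (X2 \<omega>)) \<partial>M)"
  proof (rule nn_integral_cong_AE)
    show "AE \<omega> in M. a * b + a * B (X2 \<omega>) + A (X1 \<omega>) * b + A (X1 \<omega>) * B (X2 \<omega>)
      = ennreal (f (X1 \<omega>) * g (X2 \<omega>))"
      using assms(7,8) by eventually_elim (simp add: ennreal_mult f g algebra_simps)
  qed
  finally show ?thesis
    unfolding fgs .
qed

end
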